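(* Let $G=(V,E)$ be a connected graph, $v\in V$, and let $a^{\mathsf T}x\le b$ be facet-defining for $\textsc{Bond}(G)$. Obtain $\bar G=(\bar V,\bar E)$ from $G$ by replacing $v$ by two adjacent new vertices $v_1,v_2$ and distributing the edges incident to $v$ arbitrarily among $v_1$ and $v_2$. Define $\varphi:\bar E\setminus\{v_1v_2\}\to E$ by $\varphi(e)=e$ if $v_1,v_2\notin e$, and $\varphi(e)=vw$ if $e=v_iw$ ($i=1,2$). Let $\omega$ be the weight of a maximum bond in $\bar G-v_1v_2$ separating $v_1$ and $v_2$, with respect to the edge weights $a_{\varphi(e)}$. Define $\bar a\in\mathbb{R}^{\bar E}$ by $\bar a_e=a_{\varphi(e)}$ for $e\neq v_1v_2$ and $\bar a_{v_1v_2}=b-\omega$. Then $\bar a^{\mathsf T}x\le b$ defines a facet of $\textsc{Bond}(\bar G)$.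
   Context: For a graph $G=(V,E)$ and $S\subseteq V$, the cut $\delta(S)=\{e\in E:|e\cap S|=1\}$ is a bond if $G[S]$ and $G[V\setminus S]$ are connected; it separates $u,w$ if exactly one of them lies in $S$. The weight of a bond $\delta$ w.r.t. weights $c$ is $\sum_{e\in\delta}c_e$. $x^\delta$ is the incidence vector, $\textsc{Bond}(G)=\mathrm{conv}\{x^\delta:\delta\text{ a bond}\}$. *)

theory Defs
  imports "HOL-Analysis.Analysis"
begin

definition simple_graph :: "'v set \<Rightarrow> 'v set set \<Rightarrow> bool" where
  "simple_graph V E \<longleftrightarrow> finite V \<and> (\<forall>e\<in>E. e \<subseteq> V \<and> card e = 2)"

text \<open>The graph without vertices counts as connected. Hence, in a connected graph, the empty
  cut is a bond (take \<open>S = {}\<close>).\<close>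
definition connected_graph :: "'v set \<Rightarrow> 'v set set \<Rightarrow> bool" where
  "connected_graph V E \<longleftrightarrow> (\<forall>u\<in>V. \<forall>w\<in>V. (u, w) \<in> {(x, y). {x, y} \<in> E}\<^sup>*)"

definition induced_edges :: "'v set set \<Rightarrow> 'v set \<Rightarrow> 'v set set" where
  "induced_edges E S = {e \<in> E. e \<subseteq> S}"

definition cut :: "'v set set \<Rightarrow> 'v set \<Rightarrow> 'v set set" where
  "cut E S = {e \<in> E. card (e \<inter> S) = 1}"

definition bond_side :: "'v set \<Rightarrow> 'v set set \<Rightarrow> 'v set \<Rightarrow> bool" where
  "bond_side V E S \<longleftrightarrow> S \<subseteq> V \<and> connected_graph S (induced_edges E S)
     \<and> connected_graph (V - S) (induced_edges E (V - S))"

definition bonds :: "'v set \<Rightarrow> 'v set set \<Rightarrow> 'v set set set" where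
  "bonds V E = {cut E S | S. bond_side V E S}"

definition separating_bonds :: "'v set \<Rightarrow> 'v set set \<Rightarrow> 'v \<Rightarrow> 'v \<Rightarrow> 'v set set set" where
  "separating_bonds V E u w = {cut E S | S. bond_side V E S \<and> (u \<in> S \<longleftrightarrow> w \<notin> S)}"

definition weight :: "('v set \<Rightarrow> real) \<Rightarrow> 'v set set \<Rightarrow> real" where
  "weight c D = (\<Sum>e\<in>D. c e)"

text \<open>The space \<open>\<real>\<^sup>E\<close> is represented as the coordinate subspace of \<open>real ^ 'v set\<close> of all
  vectors that vanish outside \<open>E\<close>. Faces and affine dimension do not depend on the ambient space.\<close>
definition incidence_vector :: "'v set set \<Rightarrow> real ^ ('v::finite) set" where
  "incidence_vector D = (\<chi> e. if e \<in> D then 1 else 0)"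

definition bond_polytope :: "('v::finite) set \<Rightarrow> 'v set set \<Rightarrow> (real ^ 'v set) set" where
  "bond_polytope V E = convex hull (incidence_vector ` bonds V E)"

text \<open>The inequality \<open>a\<^sup>T x \<le> b\<close> with \<open>a \<in> \<real>\<^sup>E\<close>; values of \<open>a\<close> outside \<open>E\<close> are irrelevant.\<close>
definition facet_defining ::
  "'v set set \<Rightarrow> (real ^ ('v::finite) set) set \<Rightarrow> ('v set \<Rightarrow> real) \<Rightarrow> real \<Rightarrow> bool" where
  "facet_defining E P a b \<longleftrightarrow>
     (\<forall>x\<in>P. (\<Sum>e\<in>E. a e * x $ e) \<le> b)
     \<and> {x \<in> P. (\<Sum>e\<in>E. a e * x $ e) = b} facet_of P"

definition split_vertices :: "'v set \<Rightarrow> 'v \<Rightarrow> 'v \<Rightarrow> 'v \<Rightarrow> 'v set" where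
  "split_vertices V v v1 v2 = (V - {v}) \<union> {v1, v2}"

text \<open>Of the edges incident to \<open>v\<close>, those in \<open>A\<close> are attached to \<open>v1\<close>, the others to \<open>v2\<close>.\<close>
definition split_edges :: "'v set set \<Rightarrow> 'v set set \<Rightarrow> 'v \<Rightarrow> 'v \<Rightarrow> 'v \<Rightarrow> 'v set set" where
  "split_edges E A v v1 v2 =
     {e \<in> E. v \<notin> e}
     \<union> {{v1, w} | w. {v, w} \<in> E \<and> {v, w} \<in> A}
     \<union> {{v2, w} | w. {v, w} \<in> E \<and> {v, w} \<notin> A}
     \<union> {{v1, v2}}"

definition split_map :: "'v \<Rightarrow> 'v \<Rightarrow> 'v \<Rightarrow> 'v set \<Rightarrow> 'v set" where
  "split_map v v1 v2 e = (if v1 \<notin> e \<and> v2 \<notin> e then e else insert v (e - {v1, v2}))"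

end

theory Submission
  imports Defs
begin

text \<open>Contracting the edge \<open>v1v2\<close> turns the split graph back into the original one. So the bonds of
  the split graph that avoid \<open>v1v2\<close> are the bonds of the original graph, and they embed the original
  polytope and its facet into the hyperplane \<open>x $ {v1, v2} = 0\<close>. The bonds that contain \<open>v1v2\<close> are
  those separating \<open>v1\<close> and \<open>v2\<close>; by the choice of the coefficient \<open>b - \<omega>\<close> they satisfy the new
  inequality, and a maximum one satisfies it with equality. It lies off the hyperplane, so the face
  gains a dimension. No more is needed, since bond polytopes of connected graphs are
  full-dimensional: the cut of a connected vertex set is a disjoint union of bonds, and the unit
  vector of an edge \<open>uw\<close> is half of \<open>\<delta>(u) + \<delta>(w) - \<delta>({u, w})\<close>.\<close>

section \<open>Connected vertex sets\<close>

definition adjacent_sets :: "'v set set \<Rightarrow> 'v set \<Rightarrow> 'v set \<Rightarrow> bool" where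
  "adjacent_sets E X Y \<longleftrightarrow> (\<exists>x\<in>X. \<exists>y\<in>Y. {x, y} \<in> E)"

abbreviation connected_on :: "'v set set \<Rightarrow> 'v set \<Rightarrow> bool" where
  "connected_on E S \<equiv> connected_graph S (induced_edges E S)"

abbreviation adjacency :: "'v set set \<Rightarrow> ('v \<times> 'v) set" where
  "adjacency E \<equiv> {(x, y). {x, y} \<in> E}"

lemma adjacent_setsI: "{x, y} \<in> E \<Longrightarrow> x \<in> X \<Longrightarrow> y \<in> Y \<Longrightarrow> adjacent_sets E X Y"
  unfolding adjacent_sets_def by blast

lemma adjacent_setsE:
  assumes "adjacent_sets E X Y"
  obtains x y where "{x, y} \<in> E" "x \<in> X" "y \<in> Y"
  using assms unfolding adjacent_sets_def by blast

lemma adjacent_sets_commute: "adjacent_sets E X Y \<longleftrightarrow> adjacent_sets E Y X"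
  unfolding adjacent_sets_def by (metis insert_commute)

lemma adjacent_sets_mono:
  "adjacent_sets E X Y \<Longrightarrow> X \<subseteq> X' \<Longrightarrow> Y \<subseteq> Y' \<Longrightarrow> adjacent_sets E X' Y'"
  unfolding adjacent_sets_def by blast

lemma adjacent_sets_Un:
  "adjacent_sets E (X \<union> Y) Z \<longleftrightarrow> adjacent_sets E X Z \<or> adjacent_sets E Y Z"
  "adjacent_sets E X (Y \<union> Z) \<longleftrightarrow> adjacent_sets E X Y \<or> adjacent_sets E X Z"
  unfolding adjacent_sets_def by blast+

lemma rtrancl_adjacency_closed:
  assumes "(x, y) \<in> (adjacency (induced_edges E S))\<^sup>*" "x \<in> X" "\<not> adjacent_sets E X (S - X)"
  shows "y \<in> X"
  using assms(1,2)
proof induction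
  case (step y z)
  then show ?case using assms(3) by (auto simp: induced_edges_def intro: adjacent_setsI)
qed

lemma connected_onD:
  assumes "connected_on E S" "X \<subset> S" "X \<noteq> {}"
  shows "adjacent_sets E X (S - X)"
proof (rule ccontr)
  assume nonadjacent: "\<not> adjacent_sets E X (S - X)"
  obtain x y where "x \<in> X" "y \<in> S - X" using assms(2,3) by blast
  moreover from this have "(x, y) \<in> (adjacency (induced_edges E S))\<^sup>*"
    using assms(1,2) unfolding connected_graph_def by blast
  ultimately show False using rtrancl_adjacency_closed[OF _ _ nonadjacent] by blast
qed

lemma connected_onI:
  assumes "\<And>X. x \<in> X \<Longrightarrow> X \<subset> S \<Longrightarrow> adjacent_sets E X (S - X)" and "x \<in> S"
  shows "connected_on E S"
proof -
  let ?R = "adjacency (induced_edges E S)"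
  let ?X = "{y \<in> S. (x, y) \<in> ?R\<^sup>*}"
  have "\<not> adjacent_sets E ?X (S - ?X)"
  proof
    assume "adjacent_sets E ?X (S - ?X)"
    then obtain p q where "p \<in> ?X" "q \<in> S - ?X" "{p, q} \<in> E" by (rule adjacent_setsE)
    then have "(x, q) \<in> ?R\<^sup>*" by (auto simp: induced_edges_def intro: rtrancl_into_rtrancl)
    with \<open>q \<in> S - ?X\<close> show False by blast
  qed
  then have reach: "(x, y) \<in> ?R\<^sup>*" if "y \<in> S" for y
    using assms(1)[of ?X] assms(2) that by blast
  have "sym (?R\<^sup>*)" by (intro sym_rtrancl symI) (simp add: insert_commute)
  then have "(y, z) \<in> ?R\<^sup>*" if "y \<in> S" "z \<in> S" for y z
    using reach[OF that(1)] reach[OF that(2)] by (blast dest: symD intro: rtrancl_trans)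
  then show ?thesis unfolding connected_graph_def by blast
qed

lemma connected_on_subset_cases:
  assumes "connected_on E S" "S \<subseteq> X \<union> Y" "\<not> adjacent_sets E X Y"
  shows "S \<subseteq> X \<or> S \<subseteq> Y"
proof (rule ccontr)
  assume "\<not> ?thesis"
  then have "adjacent_sets E (S \<inter> X) (S - S \<inter> X)"
    using assms by (intro connected_onD) auto
  then have "adjacent_sets E X Y" using assms(2) by (elim adjacent_sets_mono) auto
  then show False using assms(3) by contradiction
qed

lemma connected_on_empty: "connected_on E {}"
  by (simp add: connected_graph_def)

lemma connected_on_singleton: "connected_on E {x}"
  by (simp add: connected_graph_def)

lemma connected_on_Un:
  assumes "connected_on E S" "connected_on E T" "adjacent_sets E S T"
  shows "connected_on E (S \<union> T)"
proof -
  obtain x where "x \<in> S" using assms(3) by (rule adjacent_setsE)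
  show ?thesis
  proof (rule connected_onI)
    fix X assume X: "x \<in> X" "X \<subset> S \<union> T"
    show "adjacent_sets E X (S \<union> T - X)"
    proof (rule ccontr)
      assume nonadjacent: "\<not> ?thesis"
      have "S \<subseteq> X" "T \<subseteq> S \<union> T - X"
        using connected_on_subset_cases[OF assms(1) _ nonadjacent]
          connected_on_subset_cases[OF assms(2) _ nonadjacent] \<open>x \<in> S\<close> X by blast+
      then show False using nonadjacent adjacent_sets_mono[OF assms(3)] by blast
    qed
  qed (use \<open>x \<in> S\<close> in simp)
qed

lemma connected_on_image:
  assumes "connected_on E S"
    and "\<And>x y. x \<in> S \<Longrightarrow> y \<in> S \<Longrightarrow> {x, y} \<in> E \<Longrightarrow> f x = f y \<or> {f x, f y} \<in> E'"
  shows "connected_on E' (f ` S)"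
proof (cases "S = {}")
  case False
  then obtain x where "x \<in> S" by blast
  show ?thesis
  proof (rule connected_onI)
    fix X assume X: "f x \<in> X" "X \<subset> f ` S"
    have "adjacent_sets E (S \<inter> f -` X) (S - S \<inter> f -` X)"
      using X \<open>x \<in> S\<close> by (intro connected_onD[OF assms(1)]) auto
    then obtain y z where "{y, z} \<in> E" "y \<in> S \<inter> f -` X" "z \<in> S - S \<inter> f -` X"
      by (rule adjacent_setsE)
    then show "adjacent_sets E' X (f ` S - X)"
      using assms(2)[of y z] by (auto intro: adjacent_setsI[of "f y" "f z"])
  qed (use \<open>x \<in> S\<close> in simp)
qed (simp add: connected_on_empty)

lemma connected_on_if_connected_image:
  assumes "connected_on E' (f ` S)"
    and fibres: "\<And>y. y \<in> f ` S \<Longrightarrow> connected_on E {x \<in> S. f x = y}"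
    and lift_edge: "\<And>y z. y \<in> f ` S \<Longrightarrow> z \<in> f ` S \<Longrightarrow> {y, z} \<in> E'
      \<Longrightarrow> \<exists>y'\<in>S. \<exists>z'\<in>S. f y' = y \<and> f z' = z \<and> {y', z'} \<in> E"
  shows "connected_on E S"
proof (cases "S = {}")
  case False
  then obtain x where "x \<in> S" by blast
  show ?thesis
  proof (rule connected_onI)
    fix X assume X: "x \<in> X" "X \<subset> S"
    show "adjacent_sets E X (S - X)"
    proof (rule ccontr)
      assume nonadjacent: "\<not> ?thesis"
      have fibre_cases: "{x \<in> S. f x = y} \<subseteq> X \<or> {x \<in> S. f x = y} \<subseteq> S - X"
        if "y \<in> f ` S" for y
        using connected_on_subset_cases[OF fibres[OF that] _ nonadjacent] by blast
      then have saturated: "y \<in> X \<longleftrightarrow> z \<in> X" if "y \<in> S" "z \<in> S" "f y = f z" for y z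
        using that by blast
      then have "adjacent_sets E' (f ` X) (f ` S - f ` X)"
        using X by (intro connected_onD[OF assms(1)]) blast+
      then obtain y z where yz: "{y, z} \<in> E'" "y \<in> f ` X" "z \<in> f ` S - f ` X"
        by (rule adjacent_setsE)
      then obtain y' z' where lifted: "y' \<in> S" "z' \<in> S" "f y' = y" "f z' = z" "{y', z'} \<in> E"
        using lift_edge[of y z] X(2) by blast
      then have "y' \<in> X" "z' \<in> S - X" using saturated yz X(2) by blast+
      then show False using nonadjacent lifted(5) by (blast intro: adjacent_setsI)
    qed
  qed (use \<open>x \<in> S\<close> in simp)
qed (simp add: connected_on_empty)

lemma connected_on_vertices_iff:
  assumes "simple_graph V E"
  shows "connected_on E V \<longleftrightarrow> connected_graph V E"
proof -
  have "induced_edges E V = E" using assms unfolding simple_graph_def induced_edges_def by blast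
  then show ?thesis by simp
qed

definition component :: "'v set set \<Rightarrow> 'v set \<Rightarrow> 'v \<Rightarrow> 'v set" where
  "component E U x = {y. (x, y) \<in> (adjacency (induced_edges E U))\<^sup>*}"

lemma in_component: "x \<in> component E U x"
  by (simp add: component_def)

lemma component_subset:
  assumes "x \<in> U"
  shows "component E U x \<subseteq> U"
  using rtrancl_adjacency_closed[OF _ assms] unfolding component_def adjacent_sets_def by blast

lemma component_not_adjacent:
  assumes "x \<in> U"
  shows "\<not> adjacent_sets E (component E U x) (U - component E U x)"
proof
  let ?C = "component E U x"
  assume "adjacent_sets E ?C (U - ?C)"
  then obtain y z where yz: "{y, z} \<in> E" "y \<in> ?C" "z \<in> U - ?C" by (rule adjacent_setsE)
  then have "(y, z) \<in> adjacency (induced_edges E U)"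
    using component_subset[OF assms] by (auto simp: induced_edges_def)
  then have "z \<in> ?C" using yz(2) unfolding component_def by (auto intro: rtrancl_into_rtrancl)
  then show False using yz(3) by blast
qed

lemma connected_on_component:
  assumes "x \<in> U"
  shows "connected_on E (component E U x)"
proof (rule connected_onI)
  let ?C = "component E U x"
  fix X assume X: "x \<in> X" "X \<subset> ?C"
  show "adjacent_sets E X (?C - X)"
  proof (rule ccontr)
    assume "\<not> adjacent_sets E X (?C - X)"
    then have "\<not> adjacent_sets E X (U - X)"
      using component_not_adjacent[OF assms, of E] X(2) unfolding adjacent_sets_def by blast
    then have "?C \<subseteq> X"
      using rtrancl_adjacency_closed[OF _ X(1)] unfolding component_def by blast
    then show False using X(2) by blast
  qed
qed (rule in_component)

lemma bond_side_component:
  assumes conn: "connected_on E V" and S: "connected_on E S" "S \<subseteq> V" "S \<noteq> {}" and x: "x \<in> V - S"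
  shows "bond_side V E (component E (V - S) x)"
proof -
  let ?T = "component E (V - S) x"
  have T: "?T \<subseteq> V - S" by (rule component_subset[OF x])
  obtain s where s: "s \<in> S" using S(3) by blast
  have "connected_on E (V - ?T)"
  proof (rule connected_onI)
    fix X assume X: "s \<in> X" "X \<subset> V - ?T"
    let ?Y = "V - ?T - X"
    show "adjacent_sets E X ?Y"
    proof (rule ccontr)
      assume nonadjacent: "\<not> adjacent_sets E X ?Y"
      have "S \<subseteq> X"
        using connected_on_subset_cases[OF S(1) _ nonadjacent] S(2) T s X by blast
      then have "\<not> adjacent_sets E ?T ?Y"
        using component_not_adjacent[OF x, of E] adjacent_sets_mono[of E ?T ?Y ?T "V - S - ?T"]
        by blast
      moreover have "adjacent_sets E ?Y (V - ?Y)"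
        using X s S(2) by (intro connected_onD[OF conn]) auto
      then have "adjacent_sets E ?Y (X \<union> ?T)" by (rule adjacent_sets_mono) auto
      ultimately show False
        using nonadjacent by (simp add: adjacent_sets_Un adjacent_sets_commute)
    qed
  qed (use s S(2) T in blast)
  then show ?thesis
    unfolding bond_side_def using T connected_on_component[OF x] by blast
qed

lemma component_adjacent:
  assumes "connected_on E V" "S \<subseteq> V" "S \<noteq> {}" "x \<in> V - S"
  shows "adjacent_sets E S (component E (V - S) x)"
proof -
  let ?T = "component E (V - S) x"
  have "?T \<subseteq> V - S" "x \<in> ?T" using component_subset[OF assms(4)] in_component by auto
  then have "adjacent_sets E ?T (V - ?T)"
    using assms(2,3) by (intro connected_onD[OF assms(1)]) auto
  then have "adjacent_sets E ?T (S \<union> (V - S - ?T))" by (rule adjacent_sets_mono) auto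
  then show ?thesis
    using component_not_adjacent[OF assms(4), of E]
    by (simp add: adjacent_sets_Un adjacent_sets_commute)
qed

lemma ex_separating_bond_side:
  assumes "connected_on E V" "u \<in> V" "w \<in> V" "u \<noteq> w"
  obtains S where "bond_side V E S" "u \<notin> S" "w \<in> S"
proof
  let ?S = "component E (V - {u}) w"
  show "bond_side V E ?S"
    using assms by (intro bond_side_component connected_on_singleton) auto
  show "u \<notin> ?S" using component_subset[of w "V - {u}"] assms by blast
  show "w \<in> ?S" by (rule in_component)
qed

section \<open>Cuts and bonds\<close>

lemma doubleton_in_cut_iff:
  "x \<noteq> y \<Longrightarrow> {x, y} \<in> cut E S \<longleftrightarrow> {x, y} \<in> E \<and> (x \<in> S \<longleftrightarrow> y \<notin> S)"
  unfolding cut_def by (cases "x \<in> S"; cases "y \<in> S") auto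

lemma cut_subset: "cut E S \<subseteq> E"
  unfolding cut_def by blast

lemma simple_graph_edgeE:
  assumes "simple_graph V E" "e \<in> E"
  obtains x y where "e = {x, y}" "x \<noteq> y" "x \<in> V" "y \<in> V"
  using assms unfolding simple_graph_def card_2_iff by (metis insert_subset)

lemma simple_graph_edgeD: "simple_graph V E \<Longrightarrow> {x, y} \<in> E \<Longrightarrow> x \<in> V \<and> y \<in> V \<and> x \<noteq> y"
  unfolding simple_graph_def by fastforce

lemma simple_graph_edge_subset: "simple_graph V E \<Longrightarrow> e \<in> E \<Longrightarrow> e \<subseteq> V"
  unfolding simple_graph_def by blast

lemma cut_in_bonds: "bond_side V E S \<Longrightarrow> cut E S \<in> bonds V E"
  unfolding bonds_def by blast

lemma bonds_subset: "D \<in> bonds V E \<Longrightarrow> D \<subseteq> E"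
  unfolding bonds_def using cut_subset by blast

lemma separating_bonds_eq:
  assumes "{u, w} \<in> E" "u \<noteq> w"
  shows "separating_bonds V E u w = {D \<in> bonds V E. {u, w} \<in> D}"
proof -
  have "{u, w} \<in> cut E S \<longleftrightarrow> (u \<in> S \<longleftrightarrow> w \<notin> S)" for S
    using doubleton_in_cut_iff[OF assms(2)] assms(1) by simp
  then show ?thesis unfolding separating_bonds_def bonds_def by blast
qed

lemma separating_bonds_Diff_edge:
  "separating_bonds V (E - {{u, w}}) u w = (\<lambda>D. D - {{u, w}}) ` separating_bonds V E u w"
proof -
  have "bond_side V (E - {{u, w}}) S \<longleftrightarrow> bond_side V E S" if "u \<in> S \<longleftrightarrow> w \<notin> S" for S
  proof -
    have "induced_edges (E - {{u, w}}) S = induced_edges E S"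
      "induced_edges (E - {{u, w}}) (V - S) = induced_edges E (V - S)"
      using that unfolding induced_edges_def by auto
    then show ?thesis unfolding bond_side_def by simp
  qed
  moreover have "cut (E - {{u, w}}) S = cut E S - {{u, w}}" for S
    unfolding cut_def by blast
  ultimately show ?thesis
    unfolding separating_bonds_def setcompr_eq_image image_image
    by (intro image_cong Collect_cong) blast+
qed

section \<open>The bond polytope is full-dimensional\<close>

abbreviation coordinate_subspace :: "'i set \<Rightarrow> (real ^ ('i::finite)) set" where
  "coordinate_subspace I \<equiv> {x. \<forall>i. i \<notin> I \<longrightarrow> x $ i = 0}"

lemma incidence_vector_Un_cut:
  assumes "simple_graph V E" "S \<inter> T = {}"
  shows "incidence_vector (cut E S) + incidence_vector (cut E T)
    = incidence_vector (cut E (S \<union> T)) + 2 *\<^sub>R incidence_vector (cut E S \<inter> cut E T)"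
proof (rule vec_eq_iff[THEN iffD2], rule allI)
  fix e
  show "(incidence_vector (cut E S) + incidence_vector (cut E T)) $ e
    = (incidence_vector (cut E (S \<union> T)) + 2 *\<^sub>R incidence_vector (cut E S \<inter> cut E T)) $ e"
  proof (cases "e \<in> E")
    case True
    then obtain x y where "e = {x, y}" "x \<noteq> y" using simple_graph_edgeE[OF assms(1)] by metis
    with True assms(2) show ?thesis
      by (auto simp: incidence_vector_def doubleton_in_cut_iff)
  next
    case False
    then show ?thesis using cut_subset[of E] by (auto simp: incidence_vector_def)
  qed
qed

lemma cut_subset_cut_if_not_adjacent:
  assumes "simple_graph V E" "S \<inter> T = {}" "\<not> adjacent_sets E T (V - S - T)"
  shows "cut E T \<subseteq> cut E S"
proof
  fix e assume e: "e \<in> cut E T"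
  then have "e \<in> E" using cut_subset by blast
  then obtain x y where xy: "e = {x, y}" "x \<noteq> y" "x \<in> V" "y \<in> V"
    using simple_graph_edgeE[OF assms(1)] by metis
  then have "{x, y} \<in> E" "{y, x} \<in> E" using \<open>e \<in> E\<close> by (simp_all add: insert_commute)
  then show "e \<in> cut E S"
    using e xy assms(2,3) unfolding xy(1) doubleton_in_cut_iff[OF xy(2)] adjacent_sets_def by blast
qed

lemma incidence_vector_cut_component:
  assumes "simple_graph V E" "x \<in> V - S"
  shows "incidence_vector (cut E S) = incidence_vector (cut E (S \<union> component E (V - S) x))
    + incidence_vector (cut E (component E (V - S) x))"
proof -
  let ?T = "component E (V - S) x"
  have "S \<inter> ?T = {}" using component_subset[OF assms(2), of E] by blast
  moreover from this have "cut E S \<inter> cut E ?T = cut E ?T"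
    using cut_subset_cut_if_not_adjacent[OF assms(1) _ component_not_adjacent[OF assms(2)]]
    by blast
  ultimately show ?thesis
    using incidence_vector_Un_cut[OF assms(1), of S ?T] by (simp add: scaleR_2)
qed

lemma incidence_vector_cut_in_span_bonds:
  fixes V :: "'v::finite set"
  assumes G: "simple_graph V E" "connected_on E V"
    and "S \<subseteq> V" "S \<noteq> {}" "connected_on E S"
  shows "incidence_vector (cut E S) \<in> span (incidence_vector ` bonds V E)"
  using assms(3-5)
proof (induction "card (V - S)" arbitrary: S rule: less_induct)
  case less
  let ?span = "span (incidence_vector ` bonds V E)"
  show ?case
  proof (cases "V - S = {}")
    case True
    then have "bond_side V E S"
      using less.prems connected_on_empty by (auto simp: bond_side_def)
    then show ?thesis by (intro span_base imageI cut_in_bonds)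
  next
    case False
    then obtain x where x: "x \<in> V - S" by blast
    let ?T = "component E (V - S) x"
    have "?T \<subseteq> V - S" "x \<in> ?T" using component_subset[OF x] in_component by auto
    then have "card (V - (S \<union> ?T)) < card (V - S)"
      using x by (intro psubset_card_mono) auto
    moreover have "connected_on E (S \<union> ?T)"
      using connected_on_component[OF x] component_adjacent[OF G(2) less.prems(1,2) x]
      by (intro connected_on_Un less.prems(3))
    ultimately have "incidence_vector (cut E (S \<union> ?T)) \<in> ?span"
      using less.prems \<open>?T \<subseteq> V - S\<close> by (intro less.hyps) auto
    moreover have "incidence_vector (cut E ?T) \<in> ?span"
      using bond_side_component[OF G(2) less.prems(3,1,2) x]
      by (intro span_base imageI cut_in_bonds)
    ultimately show ?thesis
      unfolding incidence_vector_cut_component[OF G(1) x] by (rule span_add)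
  qed
qed

lemma unit_vector_in_span_bonds:
  fixes V :: "'v::finite set"
  assumes G: "simple_graph V E" "connected_on E V" and "e \<in> E"
  shows "incidence_vector {e} \<in> span (incidence_vector ` bonds V E)"
proof -
  obtain u w where e: "e = {u, w}" "u \<noteq> w" "u \<in> V" "w \<in> V"
    using simple_graph_edgeE[OF G(1) assms(3)] .
  let ?c = "\<lambda>S. incidence_vector (cut E S) :: real ^ 'v set"
  have "f = e" if "f \<in> cut E {u} \<inter> cut E {w}" for f
  proof -
    have "f \<in> E" using that cut_subset by blast
    then obtain x y where "f = {x, y}" "x \<noteq> y" using simple_graph_edgeE[OF G(1)] by metis
    with that e(1,2) show ?thesis by (auto simp: doubleton_in_cut_iff)
  qed
  moreover have "e \<in> cut E {u} \<inter> cut E {w}"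
    using assms(3) e(2) unfolding e(1) by (simp add: doubleton_in_cut_iff)
  ultimately have "cut E {u} \<inter> cut E {w} = {e}" by blast
  then have "incidence_vector {e} = (1/2) *\<^sub>R (?c {u} + ?c {w} - ?c {u, w})"
    using incidence_vector_Un_cut[OF G(1), of "{u}" "{w}"] e(2) by (simp add: insert_commute)
  moreover have "connected_on E {u, w}"
    using connected_on_Un[OF connected_on_singleton connected_on_singleton, of E u w] assms(3) e
    by (simp add: adjacent_sets_def insert_commute)
  then have "?c S \<in> span (incidence_vector ` bonds V E)" if "S \<in> {{u}, {w}, {u, w}}" for S
    using that e connected_on_singleton
    by (intro incidence_vector_cut_in_span_bonds[OF G]) auto
  ultimately show ?thesis by (simp add: span_add span_diff span_scale)
qed

lemma span_bonds:
  fixes V :: "'v::finite set"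
  assumes "simple_graph V E" "connected_on E V"
  shows "span (incidence_vector ` bonds V E) = coordinate_subspace E"
proof (intro equalityI subsetI)
  fix x :: "real ^ 'v set"
  assume "x \<in> coordinate_subspace E"
  then have "x = (\<Sum>e\<in>E. (x $ e) *\<^sub>R incidence_vector {e})"
    by (auto simp: vec_eq_iff incidence_vector_def if_distrib cong: if_cong)
  also have "\<dots> \<in> span (incidence_vector ` bonds V E)"
    by (intro span_sum span_scale unit_vector_in_span_bonds[OF assms])
  finally show "x \<in> span (incidence_vector ` bonds V E)" .
next
  fix x assume "x \<in> span (incidence_vector ` bonds V E)"
  moreover have "incidence_vector ` bonds V E \<subseteq> coordinate_subspace E"
    by (auto simp: incidence_vector_def dest: subsetD[OF bonds_subset])
  moreover have "subspace (coordinate_subspace E :: (real ^ 'v set) set)"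
    by (auto simp: subspace_def)
  ultimately show "x \<in> coordinate_subspace E" using span_minimal by blast
qed

lemma convex_bond_polytope: "convex (bond_polytope V E)"
  unfolding bond_polytope_def by (rule convex_convex_hull)

lemma incidence_vector_in_bond_polytope:
  "D \<in> bonds V E \<Longrightarrow> incidence_vector D \<in> bond_polytope V E"
  unfolding bond_polytope_def by (blast intro: hull_inc)

lemma span_bond_polytope:
  assumes "simple_graph V E" "connected_on E V"
  shows "span (bond_polytope V E) = coordinate_subspace E"
  unfolding span_bonds[OF assms, symmetric] bond_polytope_def
  by (intro equalityI span_mono span_minimal convex_hull_subset_span subspace_span hull_subset)

lemma aff_dim_bond_polytope:
  assumes "simple_graph V E" "connected_on E V"
  shows "aff_dim (bond_polytope V E) = int (card E)"
proof -
  have "bond_side V E {}" using assms(2) connected_on_empty by (simp add: bond_side_def)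
  then have "incidence_vector (cut E {}) \<in> bond_polytope V E"
    by (intro incidence_vector_in_bond_polytope cut_in_bonds)
  moreover have "incidence_vector (cut E {}) = 0"
    by (simp add: incidence_vector_def cut_def vec_eq_iff)
  ultimately have "aff_dim (bond_polytope V E) = int (dim (span (bond_polytope V E)))"
    by (simp add: aff_dim_zero hull_inc)
  also have "dim (span (bond_polytope V E)) = card E"
    unfolding span_bond_polytope[OF assms] by (simp add: dim_substandard_cart flip: dim_vec_eq)
  finally show ?thesis .
qed

section \<open>Lifting facets\<close>

abbreviation linear_form :: "'i set \<Rightarrow> ('i \<Rightarrow> real) \<Rightarrow> real ^ ('i::finite) \<Rightarrow> real" where
  "linear_form E a x \<equiv> (\<Sum>e\<in>E. a e * x $ e)"

lemma linear_form_eq_inner: "linear_form E a x = (\<chi> e. if e \<in> E then a e else 0) \<bullet> x"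
proof -
  have "linear_form E a x = (\<Sum>e\<in>UNIV. if e \<in> E then a e * x $ e else 0)"
    by (simp add: sum.inter_restrict[symmetric])
  also have "\<dots> = (\<chi> e. if e \<in> E then a e else 0) \<bullet> x"
    unfolding inner_vec_def by (intro sum.cong) auto
  finally show ?thesis .
qed

lemma linear_form_incidence_vector:
  fixes a :: "('v::finite) set \<Rightarrow> real"
  assumes "D \<subseteq> E"
  shows "linear_form E a (incidence_vector D) = weight a D"
proof -
  have "linear_form E a (incidence_vector D) = (\<Sum>e\<in>E. if e \<in> D then a e else 0)"
    by (intro sum.cong) (auto simp: incidence_vector_def)
  also have "\<dots> = weight a (E \<inter> D)"
    unfolding weight_def by (simp add: sum.inter_restrict)
  also have "E \<inter> D = D" using assms by blast
  finally show ?thesis .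
qed

lemma linear_form_le_bond_polytope_iff:
  "(\<forall>x\<in>bond_polytope V E. linear_form E a x \<le> b) \<longleftrightarrow> (\<forall>D\<in>bonds V E. weight a D \<le> b)"
proof -
  have "convex {x. linear_form E a x \<le> b}"
    unfolding linear_form_eq_inner by (rule convex_halfspace_le)
  then have "bond_polytope V E \<subseteq> {x. linear_form E a x \<le> b}
      \<longleftrightarrow> incidence_vector ` bonds V E \<subseteq> {x. linear_form E a x \<le> b}"
    unfolding bond_polytope_def by (rule subset_hull)
  moreover have "linear_form E a (incidence_vector D) = weight a D" if "D \<in> bonds V E" for D
    using bonds_subset[OF that] by (rule linear_form_incidence_vector)
  ultimately show ?thesis by (simp add: subset_eq)
qed

lemma linear_form_face_of:
  assumes "convex P" "\<forall>x\<in>P. linear_form E a x \<le> b"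
  shows "{x \<in> P. linear_form E a x = b} face_of P"
  using face_of_Int_supporting_hyperplane_le[OF assms(1)] assms(2)
  unfolding linear_form_eq_inner Int_def by auto

lemma aff_dim_linear_image_inj_on_span:
  fixes f :: "'a::euclidean_space \<Rightarrow> 'b::euclidean_space"
  assumes "linear f" "inj_on f (span S)"
  shows "aff_dim (f ` S) = aff_dim S"
proof (rule antisym)
  show "aff_dim (f ` S) \<le> aff_dim S" by (rule aff_dim_linear_image_le[OF assms(1)])
  obtain g where g: "linear g" "\<forall>x\<in>span S. g (f x) = x"
    using linear_inj_on_left_inverse[OF assms] by blast
  then have "g ` f ` S = S" by (simp add: image_image span_base cong: image_cong)
  then show "aff_dim S \<le> aff_dim (f ` S)" using aff_dim_linear_image_le[OF g(1)] by metis
qed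

lemma facet_defining_lift:
  fixes P :: "(real ^ ('v::finite) set) set" and Q :: "(real ^ ('w::finite) set) set"
  assumes facet: "facet_defining E P a b"
    and linear: "linear f" and inj: "inj_on f (span P)" and image: "f ` P \<subseteq> Q"
    and linear_form_f: "\<And>x. linear_form E' a' (f x) = linear_form E a x"
    and convex: "convex Q" and dim: "aff_dim Q \<le> aff_dim P + 1"
    and valid: "\<forall>y\<in>Q. linear_form E' a' y \<le> b"
    and tight: "p \<in> Q" "linear_form E' a' p = b" and off_hull: "p \<notin> affine hull (f ` P)"
  shows "facet_defining E' Q a' b"
proof -
  define F where "F = {x \<in> P. linear_form E a x = b}"
  define F' where "F' = {y \<in> Q. linear_form E' a' y = b}"
  have facet_F: "F facet_of P" using facet unfolding facet_defining_def F_def by blast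
  have face: "F' face_of Q" unfolding F'_def by (rule linear_form_face_of[OF convex valid])
  have image_F: "f ` F \<subseteq> F'" using image linear_form_f unfolding F_def F'_def by auto
  have "F \<subseteq> P" "F \<noteq> P" using facet_F unfolding facet_of_def F_def by auto
  then have "affine hull (f ` F) \<subseteq> affine hull (f ` P)" by (intro hull_mono image_mono)
  then have "p \<notin> affine hull (f ` F)" using off_hull by blast
  moreover have "inj_on f (span F)" using inj span_mono[OF \<open>F \<subseteq> P\<close>] by (rule inj_on_subset)
  ultimately have "aff_dim F + 1 = aff_dim (insert p (f ` F))"
    by (simp add: aff_dim_insert aff_dim_linear_image_inj_on_span[OF linear])
  also have "\<dots> \<le> aff_dim F'"
    using image_F tight unfolding F'_def by (intro aff_dim_subset) blast
  finally have "aff_dim F + 1 \<le> aff_dim F'" .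
  moreover have "aff_dim F = aff_dim P - 1" using facet_F unfolding facet_of_def by blast
  moreover have "F' \<noteq> Q"
  proof -
    obtain x where "x \<in> P" "x \<notin> F" using \<open>F \<subseteq> P\<close> \<open>F \<noteq> P\<close> by blast
    then have "f x \<in> Q" "f x \<notin> F'" using image linear_form_f unfolding F_def F'_def by auto
    then show ?thesis by blast
  qed
  then have "aff_dim F' < aff_dim Q" by (rule face_of_aff_dim_lt[OF convex face])
  ultimately have "aff_dim F' = aff_dim Q - 1" using dim by linarith
  moreover have "F' \<noteq> {}" using tight unfolding F'_def by blast
  ultimately have "F' facet_of Q" using face unfolding facet_of_def by blast
  then show ?thesis using valid unfolding facet_defining_def F'_def by blast
qed

section \<open>Splitting a vertex\<close>

locale vertex_split =
  fixes V :: "'v::finite set" and E A :: "'v set set" and v v1 v2 :: 'v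
  assumes graph: "simple_graph V E"
    and v_in: "v \<in> V" and v1_notin: "v1 \<notin> V" and v2_notin: "v2 \<notin> V" and v1_neq_v2: "v1 \<noteq> v2"
begin

abbreviation Vbar :: "'v set" where "Vbar \<equiv> split_vertices V v v1 v2"
abbreviation Ebar :: "'v set set" where "Ebar \<equiv> split_edges E A v v1 v2"
abbreviation \<phi> :: "'v set \<Rightarrow> 'v set" where "\<phi> \<equiv> split_map v v1 v2"

definition proj :: "'v \<Rightarrow> 'v" where
  "proj x = (if x = v1 \<or> x = v2 then v else x)"

text \<open>The end of the edge of \<open>Ebar\<close> corresponding to \<open>f\<close> that lies over the end \<open>x\<close> of \<open>f\<close>.\<close>
definition lift_end :: "'v set \<Rightarrow> 'v \<Rightarrow> 'v" where
  "lift_end f x = (if x = v then if f \<in> A then v1 else v2 else x)"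

definition lift_edge :: "'v set \<Rightarrow> 'v set" where
  "lift_edge f = lift_end f ` f"

definition lift_vertices :: "'v set \<Rightarrow> 'v set" where
  "lift_vertices S = {x \<in> Vbar. proj x \<in> S}"

lemma proj_in: "x \<in> Vbar \<Longrightarrow> proj x \<in> V"
  using v_in by (auto simp: proj_def split_vertices_def)

lemma proj_eq_iff:
  "x \<in> Vbar \<Longrightarrow> y \<in> Vbar \<Longrightarrow> proj x = proj y \<longleftrightarrow> x = y \<or> {x, y} = {v1, v2}"
  by (auto simp: proj_def split_vertices_def doubleton_eq_iff)

lemma lift_end_in: "x \<in> V \<Longrightarrow> lift_end f x \<in> Vbar"
  by (simp add: lift_end_def split_vertices_def)

lemma proj_lift_end: "x \<in> V \<Longrightarrow> proj (lift_end f x) = x"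
  using v1_notin v2_notin by (auto simp: proj_def lift_end_def)

lemma split_map_eq_image: "\<phi> e = proj ` e"
  unfolding split_map_def proj_def by auto

lemma split_map_lift_edge:
  assumes "f \<in> E"
  shows "\<phi> (lift_edge f) = f"
proof -
  have "proj (lift_end f x) = x" if "x \<in> f" for x
    using proj_lift_end simple_graph_edge_subset[OF graph assms] that by blast
  then show ?thesis unfolding split_map_eq_image lift_edge_def image_image by simp
qed

lemma new_edge_notin_lift_edge: "{v1, v2} \<notin> lift_edge ` E"
proof
  assume "{v1, v2} \<in> lift_edge ` E"
  then obtain f where "f \<in> E" "{v1, v2} = lift_edge f" by blast
  moreover have "\<phi> {v1, v2} = {v}" by (auto simp: split_map_def)
  ultimately have "{v, v} \<in> E" using split_map_lift_edge by force
  then show False using simple_graph_edgeD[OF graph] by blast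
qed

lemma lift_edge_not_incident: "v \<notin> f \<Longrightarrow> lift_edge f = f"
  unfolding lift_edge_def lift_end_def by (force simp: image_iff)

lemma lift_edge_incident:
  assumes "{v, w} \<in> E"
  shows "lift_edge {v, w} = {if {v, w} \<in> A then v1 else v2, w}"
  using simple_graph_edgeD[OF graph assms] by (auto simp: lift_edge_def lift_end_def)

lemma split_edges_eq: "Ebar = insert {v1, v2} (lift_edge ` E)"
proof -
  let ?old = "{e \<in> E. v \<notin> e}"
  let ?at_v1 = "{w. {v, w} \<in> E \<and> {v, w} \<in> A}" and ?at_v2 = "{w. {v, w} \<in> E \<and> {v, w} \<notin> A}"
  have "f \<in> ?old \<union> (\<lambda>w. {v, w}) ` ?at_v1 \<union> (\<lambda>w. {v, w}) ` ?at_v2" if edge: "f \<in> E" for f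
  proof -
    obtain x y where "f = {x, y}" using simple_graph_edgeE[OF graph edge] .
    with edge show ?thesis by (auto simp: insert_commute)
  qed
  then have "E = ?old \<union> (\<lambda>w. {v, w}) ` ?at_v1 \<union> (\<lambda>w. {v, w}) ` ?at_v2" by blast
  then have "lift_edge ` E = lift_edge ` ?old
      \<union> (\<lambda>w. lift_edge {v, w}) ` ?at_v1 \<union> (\<lambda>w. lift_edge {v, w}) ` ?at_v2"
    by (metis image_Un image_image)
  also have "\<dots> = ?old \<union> (\<lambda>w. {v1, w}) ` ?at_v1 \<union> (\<lambda>w. {v2, w}) ` ?at_v2"
    by (simp add: lift_edge_not_incident lift_edge_incident cong: image_cong_simp)
  finally show ?thesis unfolding split_edges_def setcompr_eq_image by simp
qed

lemma new_edge_in_split_edges: "{v1, v2} \<in> Ebar"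
  unfolding split_edges_def by blast

lemma split_edges_Diff: "Ebar - {{v1, v2}} = lift_edge ` E"
  using split_edges_eq new_edge_notin_lift_edge by blast

lemma bij_betw_split_map: "bij_betw \<phi> (Ebar - {{v1, v2}}) E"
  unfolding split_edges_Diff
  by (rule bij_betw_byWitness[where f' = lift_edge]) (auto simp: split_map_lift_edge)

lemma card_split_edges: "card Ebar = Suc (card E)"
  using bij_betw_same_card[OF bij_betw_split_map] card.remove[OF _ new_edge_in_split_edges] by simp

lemma proj_edge:
  assumes "{x, y} \<in> Ebar"
  shows "proj x = proj y \<or> {proj x, proj y} \<in> E"
proof (cases "{x, y} = {v1, v2}")
  case True
  then show ?thesis by (auto simp: proj_def doubleton_eq_iff)
next
  case False
  then have "\<phi> {x, y} \<in> E" using assms bij_betw_split_map unfolding bij_betw_def by blast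
  then show ?thesis by (simp add: split_map_eq_image)
qed

lemma simple_graph_split: "simple_graph Vbar Ebar"
proof -
  have "lift_edge f \<subseteq> Vbar \<and> card (lift_edge f) = 2" if "f \<in> E" for f
  proof -
    have "inj_on (lift_end f) f"
      using simple_graph_edge_subset[OF graph that] proj_lift_end
      by (intro inj_on_inverseI[where g = proj]) blast
    then have "card (lift_edge f) = card f" unfolding lift_edge_def by (rule card_image)
    then show ?thesis
      using graph that simple_graph_edge_subset[OF graph that] lift_end_in
      unfolding simple_graph_def lift_edge_def by auto
  qed
  then show ?thesis
    unfolding simple_graph_def split_edges_eq split_vertices_def using v1_neq_v2 by auto
qed

lemma lift_vertices_subset: "lift_vertices S \<subseteq> Vbar"
  unfolding lift_vertices_def by blast

lemma lift_vertices_Diff: "lift_vertices (V - S) = Vbar - lift_vertices S"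
  using proj_in unfolding lift_vertices_def by blast

lemma lift_vertices_proj_image:
  assumes "S \<subseteq> Vbar" "v1 \<in> S \<longleftrightarrow> v2 \<in> S"
  shows "lift_vertices (proj ` S) = S"
  using assms proj_eq_iff unfolding lift_vertices_def by (auto simp: doubleton_eq_iff)

lemma proj_image_lift_vertices:
  assumes "S \<subseteq> V"
  shows "proj ` lift_vertices S = S"
proof
  show "S \<subseteq> proj ` lift_vertices S"
  proof
    fix x assume "x \<in> S"
    then have "lift_end {} x \<in> lift_vertices S" "proj (lift_end {} x) = x"
      using assms proj_lift_end lift_end_in unfolding lift_vertices_def by auto
    then show "x \<in> proj ` lift_vertices S" by force
  qed
qed (auto simp: lift_vertices_def)

lemma connected_on_proj_fibre: "connected_on Ebar {x \<in> lift_vertices S. proj x = y}"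
proof (cases "{x \<in> lift_vertices S. proj x = y} = {}")
  case False
  then obtain x where x: "x \<in> lift_vertices S" "proj x = y" by blast
  show ?thesis
  proof (rule connected_onI)
    let ?F = "{x \<in> lift_vertices S. proj x = y}"
    fix X assume X: "x \<in> X" "X \<subset> ?F"
    then obtain z where z: "z \<in> ?F - X" by blast
    then have "{x, z} = {v1, v2}"
      using proj_eq_iff[of x z] x X(1) lift_vertices_subset by blast
    then have "{x, z} \<in> Ebar" using new_edge_in_split_edges by simp
    then show "adjacent_sets Ebar X (?F - X)" using X(1) z by (rule adjacent_setsI)
  qed (use x in simp)
qed (simp only: connected_on_empty)

lemma connected_on_lift_vertices_iff:
  assumes "S \<subseteq> V"
  shows "connected_on Ebar (lift_vertices S) \<longleftrightarrow> connected_on E S"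
proof
  assume "connected_on Ebar (lift_vertices S)"
  then have "connected_on E (proj ` lift_vertices S)"
    using proj_edge by (rule connected_on_image)
  then show "connected_on E S" by (simp add: proj_image_lift_vertices[OF assms])
next
  assume conn: "connected_on E S"
  show "connected_on Ebar (lift_vertices S)"
  proof (rule connected_on_if_connected_image)
    show "connected_on E (proj ` lift_vertices S)"
      by (simp add: proj_image_lift_vertices[OF assms] conn)
  next
    fix y z assume yz: "y \<in> proj ` lift_vertices S" "z \<in> proj ` lift_vertices S" "{y, z} \<in> E"
    let ?l = "lift_end {y, z}"
    have "{?l y, ?l z} \<in> Ebar"
      using yz(3) unfolding split_edges_eq lift_edge_def by force
    moreover have "?l x \<in> lift_vertices S \<and> proj (?l x) = x"
      if "x \<in> proj ` lift_vertices S" for x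
      using that assms proj_lift_end lift_end_in unfolding proj_image_lift_vertices[OF assms]
      by (auto simp: lift_vertices_def)
    ultimately show "\<exists>y'\<in>lift_vertices S. \<exists>z'\<in>lift_vertices S.
        proj y' = y \<and> proj z' = z \<and> {y', z'} \<in> Ebar"
      using yz(1,2) by blast
  qed (rule connected_on_proj_fibre)
qed

lemma connected_on_split_vertices:
  assumes "connected_on E V"
  shows "connected_on Ebar Vbar"
proof -
  have "lift_vertices V = Vbar" using proj_in unfolding lift_vertices_def by blast
  then show ?thesis using connected_on_lift_vertices_iff[of V] assms by simp
qed

lemma bond_side_lift_vertices_iff:
  "S \<subseteq> V \<Longrightarrow> bond_side Vbar Ebar (lift_vertices S) \<longleftrightarrow> bond_side V E S"
  by (simp add: bond_side_def lift_vertices_subset connected_on_lift_vertices_iff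
      flip: lift_vertices_Diff)

lemma new_edge_in_cut_iff: "{v1, v2} \<in> cut Ebar S \<longleftrightarrow> (v1 \<in> S \<longleftrightarrow> v2 \<notin> S)"
  using doubleton_in_cut_iff[OF v1_neq_v2] new_edge_in_split_edges by simp

lemma new_edge_notin_cut_lift_vertices: "{v1, v2} \<notin> cut Ebar (lift_vertices S)"
  unfolding new_edge_in_cut_iff by (simp add: lift_vertices_def split_vertices_def proj_def)

lemma in_cut_lift_vertices_iff:
  assumes e: "e \<in> Ebar - {{v1, v2}}"
  shows "e \<in> cut Ebar (lift_vertices S) \<longleftrightarrow> \<phi> e \<in> cut E S"
proof -
  have "e \<in> Ebar" using e by simp
  then obtain x y where xy: "e = {x, y}" "x \<noteq> y" "x \<in> Vbar" "y \<in> Vbar"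
    by (rule simple_graph_edgeE[OF simple_graph_split])
  then have "proj x \<noteq> proj y" using proj_eq_iff e by blast
  moreover have "\<phi> e \<in> E" using e bij_betw_split_map unfolding bij_betw_def by blast
  ultimately show ?thesis
    using \<open>e \<in> Ebar\<close> xy by (simp add: split_map_eq_image doubleton_in_cut_iff lift_vertices_def)
qed

lemma bonds_avoiding_new_edge:
  "{D \<in> bonds Vbar Ebar. {v1, v2} \<notin> D} = (\<lambda>S. cut Ebar (lift_vertices S)) ` {S. bond_side V E S}"
proof (intro equalityI subsetI)
  fix D assume "D \<in> {D \<in> bonds Vbar Ebar. {v1, v2} \<notin> D}"
  then obtain S where S: "D = cut Ebar S" "bond_side Vbar Ebar S" "v1 \<in> S \<longleftrightarrow> v2 \<in> S"
    unfolding bonds_def using new_edge_in_cut_iff by blast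
  then have "S \<subseteq> Vbar" unfolding bond_side_def by blast
  then have lift: "lift_vertices (proj ` S) = S" and "proj ` S \<subseteq> V"
    using lift_vertices_proj_image S(3) proj_in by auto
  then have "bond_side V E (proj ` S)"
    using S(2) bond_side_lift_vertices_iff[of "proj ` S"] by simp
  moreover have "D = cut Ebar (lift_vertices (proj ` S))" by (simp add: lift S(1))
  ultimately show "D \<in> (\<lambda>S. cut Ebar (lift_vertices S)) ` {S. bond_side V E S}" by blast
next
  fix D assume "D \<in> (\<lambda>S. cut Ebar (lift_vertices S)) ` {S. bond_side V E S}"
  then obtain S where S: "D = cut Ebar (lift_vertices S)" "bond_side V E S" by blast
  then have "S \<subseteq> V" unfolding bond_side_def by blast
  then have "bond_side Vbar Ebar (lift_vertices S)" using S(2) bond_side_lift_vertices_iff by simp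
  with S(1) show "D \<in> {D \<in> bonds Vbar Ebar. {v1, v2} \<notin> D}"
    using cut_in_bonds new_edge_notin_cut_lift_vertices by simp
qed

section \<open>Lifting facets along a vertex split\<close>

definition embed :: "real ^ 'v set \<Rightarrow> real ^ 'v set" where
  "embed x = (\<chi> e. if e \<in> Ebar - {{v1, v2}} then x $ \<phi> e else 0)"

lemma linear_embed: "linear embed"
  by (rule linearI) (auto simp: embed_def vec_eq_iff)

lemma inj_on_embed: "inj_on embed (coordinate_subspace E)"
proof (rule inj_onI)
  fix x y assume xy: "x \<in> coordinate_subspace E" "y \<in> coordinate_subspace E"
    and eq: "embed x = embed y"
  have "x $ f = y $ f" if "f \<in> E" for f
  proof -
    have "embed x $ lift_edge f = embed y $ lift_edge f" by (simp add: eq)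
    moreover have "lift_edge f \<in> Ebar - {{v1, v2}}" using that split_edges_Diff by blast
    ultimately show ?thesis by (simp add: embed_def split_map_lift_edge[OF that])
  qed
  moreover have "x $ f = y $ f" if "f \<notin> E" for f using xy that by simp
  ultimately show "x = y" unfolding vec_eq_iff by blast
qed

lemma embed_incidence_vector:
  "embed (incidence_vector (cut E S)) = incidence_vector (cut Ebar (lift_vertices S))"
proof -
  have "e \<in> cut Ebar (lift_vertices S) \<longleftrightarrow> e \<in> Ebar - {{v1, v2}} \<and> \<phi> e \<in> cut E S" for e
    using in_cut_lift_vertices_iff[of e S] new_edge_notin_cut_lift_vertices[of S] cut_subset by blast
  then show ?thesis by (simp add: embed_def incidence_vector_def vec_eq_iff)
qed

lemma embed_bonds:
  "embed ` incidence_vector ` bonds V E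
    = incidence_vector ` {D \<in> bonds Vbar Ebar. {v1, v2} \<notin> D}"
  unfolding bonds_avoiding_new_edge
  by (simp add: bonds_def setcompr_eq_image image_image embed_incidence_vector)

lemma embed_bond_polytope: "embed ` bond_polytope V E \<subseteq> bond_polytope Vbar Ebar"
  unfolding bond_polytope_def convex_hull_linear_image[OF linear_embed] embed_bonds
  by (intro hull_mono image_mono) blast

definition split_coeffs :: "('v set \<Rightarrow> real) \<Rightarrow> real \<Rightarrow> 'v set \<Rightarrow> real" where
  "split_coeffs a c = (\<lambda>e. if e = {v1, v2} then c else a (\<phi> e))"

definition max_separating_weight :: "('v set \<Rightarrow> real) \<Rightarrow> real" where
  "max_separating_weight a =
    Max (weight (\<lambda>e. a (\<phi> e)) ` separating_bonds Vbar (Ebar - {{v1, v2}}) v1 v2)"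

lemma linear_form_embed: "linear_form Ebar (split_coeffs a c) (embed x) = linear_form E a x"
proof -
  have "linear_form Ebar (split_coeffs a c) (embed x)
      = linear_form (Ebar - {{v1, v2}}) (split_coeffs a c) (embed x)"
    by (rule sum.mono_neutral_right) (auto simp: embed_def)
  also have "\<dots> = (\<Sum>e\<in>Ebar - {{v1, v2}}. a (\<phi> e) * x $ \<phi> e)"
    by (intro sum.cong) (auto simp: embed_def split_coeffs_def)
  also have "\<dots> = linear_form E a x"
    by (rule sum.reindex_bij_betw[OF bij_betw_split_map])
  finally show ?thesis .
qed

lemma weight_split_coeffs:
  assumes "{v1, v2} \<in> D"
  shows "weight (split_coeffs a c) D = c + weight (\<lambda>e. a (\<phi> e)) (D - {{v1, v2}})"
proof -
  have "weight (split_coeffs a c) D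
      = split_coeffs a c {v1, v2} + weight (split_coeffs a c) (D - {{v1, v2}})"
    unfolding weight_def using assms by (intro sum.remove) simp_all
  also have "weight (split_coeffs a c) (D - {{v1, v2}}) = weight (\<lambda>e. a (\<phi> e)) (D - {{v1, v2}})"
    unfolding weight_def by (intro sum.cong) (auto simp: split_coeffs_def)
  finally show ?thesis by (simp add: split_coeffs_def)
qed

lemma max_separating_weight_eq:
  "max_separating_weight a
    = Max ((\<lambda>D. weight (\<lambda>e. a (\<phi> e)) (D - {{v1, v2}})) ` {D \<in> bonds Vbar Ebar. {v1, v2} \<in> D})"
  unfolding max_separating_weight_def separating_bonds_Diff_edge
    separating_bonds_eq[OF new_edge_in_split_edges v1_neq_v2] image_image ..

lemma weight_split_coeffs_le:
  assumes valid: "\<forall>D\<in>bonds V E. weight a D \<le> b" and D: "D \<in> bonds Vbar Ebar"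
  shows "weight (split_coeffs a (b - max_separating_weight a)) D \<le> b"
proof (cases "{v1, v2} \<in> D")
  case True
  then have "weight (\<lambda>e. a (\<phi> e)) (D - {{v1, v2}}) \<le> max_separating_weight a"
    unfolding max_separating_weight_eq using D by (intro Max_ge) auto
  then show ?thesis by (simp add: weight_split_coeffs[OF True])
next
  case False
  then obtain D' where D': "D' \<in> bonds V E" "incidence_vector D = embed (incidence_vector D')"
    using D embed_bonds by blast
  have "weight (split_coeffs a (b - max_separating_weight a)) D = weight a D'"
    using linear_form_embed[of a _ "incidence_vector D'"] bonds_subset[OF D] bonds_subset[OF D'(1)]
    by (simp add: linear_form_incidence_vector flip: D'(2))
  then show ?thesis using valid D'(1) by simp
qed

lemma ex_tight_bond_through_new_edge:
  assumes "connected_on E V"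
  obtains D where "D \<in> bonds Vbar Ebar" "{v1, v2} \<in> D"
    "weight (split_coeffs a (b - max_separating_weight a)) D = b"
proof -
  let ?sep = "{D \<in> bonds Vbar Ebar. {v1, v2} \<in> D}"
  obtain S where "bond_side Vbar Ebar S" "v1 \<notin> S" "v2 \<in> S"
    using ex_separating_bond_side[OF connected_on_split_vertices[OF assms] _ _ v1_neq_v2]
    unfolding split_vertices_def by blast
  then have "cut Ebar S \<in> ?sep" using cut_in_bonds new_edge_in_cut_iff by blast
  then have "max_separating_weight a \<in> (\<lambda>D. weight (\<lambda>e. a (\<phi> e)) (D - {{v1, v2}})) ` ?sep"
    unfolding max_separating_weight_eq by (intro Max_in) auto
  then obtain D where D: "D \<in> bonds Vbar Ebar" "{v1, v2} \<in> D"
    "max_separating_weight a = weight (\<lambda>e. a (\<phi> e)) (D - {{v1, v2}})"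
    by blast
  show ?thesis
  proof (rule that[OF D(1,2)])
    show "weight (split_coeffs a (b - max_separating_weight a)) D = b"
      by (simp add: weight_split_coeffs[OF D(2)] D(3))
  qed
qed

lemma facet_defining_split:
  assumes conn: "connected_on E V" and facet: "facet_defining E (bond_polytope V E) a b"
  shows "facet_defining Ebar (bond_polytope Vbar Ebar)
    (split_coeffs a (b - max_separating_weight a)) b"
proof -
  let ?P = "bond_polytope V E" and ?Pbar = "bond_polytope Vbar Ebar"
  let ?abar = "split_coeffs a (b - max_separating_weight a)"
  have inj: "inj_on embed (span ?P)"
    unfolding span_bond_polytope[OF graph conn] by (rule inj_on_embed)
  have dim: "aff_dim ?Pbar \<le> aff_dim ?P + 1"
    using aff_dim_bond_polytope[OF graph conn] card_split_edges
      aff_dim_bond_polytope[OF simple_graph_split connected_on_split_vertices[OF conn]] by simp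
  have "\<forall>D\<in>bonds V E. weight a D \<le> b"
    using facet unfolding facet_defining_def linear_form_le_bond_polytope_iff by blast
  then have valid: "\<forall>y\<in>?Pbar. linear_form Ebar ?abar y \<le> b"
    unfolding linear_form_le_bond_polytope_iff by (blast intro: weight_split_coeffs_le)
  obtain D where D: "D \<in> bonds Vbar Ebar" "{v1, v2} \<in> D" "weight ?abar D = b"
    by (rule ex_tight_bond_through_new_edge[OF conn])
  have "affine hull (embed ` ?P) \<subseteq> {x. x $ {v1, v2} = 0}"
    by (rule hull_minimal) (auto simp: embed_def affine_def)
  then have "incidence_vector D \<notin> affine hull (embed ` ?P)"
    using D(2) by (auto simp: incidence_vector_def)
  moreover have "linear_form Ebar ?abar (incidence_vector D) = b"
    using D(3) linear_form_incidence_vector[OF bonds_subset[OF D(1)]] by simp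
  ultimately show ?thesis
    using facet_defining_lift[OF facet linear_embed inj embed_bond_polytope linear_form_embed
        convex_bond_polytope dim valid incidence_vector_in_bond_polytope[OF D(1)]]
    by blast
qed

end

theorem theorem4p1:
  fixes V Vbar :: "('v::finite) set" and E Ebar A :: "'v set set"
    and v v1 v2 :: 'v
    and a abar :: "'v set \<Rightarrow> real" and b \<omega> :: real
    and \<phi> :: "'v set \<Rightarrow> 'v set"
  assumes "simple_graph V E" and "connected_graph V E" and "v \<in> V"
    and "facet_defining E (bond_polytope V E) a b"
    and "v1 \<notin> V" and "v2 \<notin> V" and "v1 \<noteq> v2"
    and "A \<subseteq> {e \<in> E. v \<in> e}"
    and "Vbar = split_vertices V v v1 v2"
    and "Ebar = split_edges E A v v1 v2"
    and "\<phi> = split_map v v1 v2"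
    and "\<omega> = Max (weight (\<lambda>e. a (\<phi> e)) ` separating_bonds Vbar (Ebar - {{v1, v2}}) v1 v2)"
    and "abar = (\<lambda>e. if e = {v1, v2} then b - \<omega> else a (\<phi> e))"
  shows "facet_defining Ebar (bond_polytope Vbar Ebar) abar b"
proof -
  interpret vertex_split V E A v v1 v2
    using assms by unfold_locales
  have "connected_on E V"
    using assms(1,2) connected_on_vertices_iff by blast
  from facet_defining_split[OF this assms(4)] show ?thesis
    unfolding assms(9-13) split_coeffs_def max_separating_weight_def .
qed

end
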